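(* Let $F$ be a finitely generated free group, and let $N\subseteq N_1$ be normal subgroups of $F$. Let $P=F/N$ be LEF and centreless, and let $P_1=N_1/N$ be LEF-separated in $P$. Then $P$ embeds into a metric ultraproduct of finite groups with trivial centre, with metrics defined by pseudo length functions of the form $(l_c)^{*st}_{H}$, in such a way that $P_1$ consists exactly of all elements of $P$ whose norm in the ultraproduct is $\le\frac12$.
   Context: A pseudo length function on a group $G$ is $l:G\to[0,\infty)$ with $l(1)=0$, $l(g)=l(g^{-1})$, $l(gh)\le l(g)+l(h)$; it is invariant if $l(h^{-1}gh)=l(g)$ for all $g,h\in G$. Metric ultraproduct: for a family $(G_i,l_i)_{i\in I}$ of groups with invariant (pseudo) length functions bounded by a common constant, and an ultrafilter $\Phi$ on $I$, let $N_\Phi=\{(x_i)\in\prod_I G_i:\lim_{i\to\Phi}l_i(x_i)=0\}$; the metric ultraproduct is $(\prod_I G_i)/N_\Phi$ with length function (norm) $l((x_i)N_\Phi)=\lim_{i\to\Phi}l_i(x_i)$. Conjugacy length of a finite group $G$: $l_c(g)=\frac{\log|g^G|}{\log|G|}$, where $g^G$ is the conjugacy class of $g$; it is an invariant pseudo length function bounded by $1$. For a normal subgroup $H$ of $G$ and natural numbers $s,t\ge 1$, define $(l_c)^{*st}_H(g)=\frac{\sqrt[s]{l_c(g)}}{t+1}$ if $g\in H$ and $(l_c)^{*st}_H(g)=1$ if $g\notin H$. In the metric ultraproduct, $s$, $t$ and $H$ may vary with the factor. A group $P$ is LEF if for every finite subset $D\subseteq P$ there are a finite group $C$ and an injective map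 $\phi:D\to C$ such that $\phi(hg)=\phi(h)\phi(g)$ whenever $h,g,hg\in D$. LEF-separated: with $P=F/N$, $P_1=N_1/N$ as in the claim, $P_1$ is LEF-separated in $P$ if for any finite subsets $D_1\subseteq N$ and $D_2\subset F\setminus N$ there is a homomorphism $\phi$ from $F$ to a finite group $C$ such that $\phi(D_1)=\{e\}$ (or $D_1=\emptyset$), $e\notin\phi(D_2)$, and $\phi(D_2\setminus N_1)\cap\phi(N_1)=\emptyset$. *)

theory Defs
  imports Complex_Main "HOL-Algebra.Generated_Groups" "HOL-Algebra.Product_Groups"
begin

section \<open>Free groups\<close>

text \<open>
  Words over a set \<open>S\<close> of group elements are lists of letters \<open>(a, e)\<close> with \<open>a \<in> S\<close>; the letter
  \<open>(a, True)\<close> stands for \<open>a\<close> and \<open>(a, False)\<close> for its inverse.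
\<close>

definition letter_val :: "('a, 'b) monoid_scheme \<Rightarrow> 'a \<times> bool \<Rightarrow> 'a" where
  "letter_val G p = (if snd p then fst p else inv\<^bsub>G\<^esub> (fst p))"

definition word_val :: "('a, 'b) monoid_scheme \<Rightarrow> ('a \<times> bool) list \<Rightarrow> 'a" where
  "word_val G w = foldr (\<lambda>p y. letter_val G p \<otimes>\<^bsub>G\<^esub> y) w \<one>\<^bsub>G\<^esub>"

definition reduced_word :: "('a \<times> bool) list \<Rightarrow> bool" where
  "reduced_word w \<longleftrightarrow> successively (\<lambda>p q. \<not> (fst p = fst q \<and> snd p \<noteq> snd q)) w"

definition free_basis :: "('a, 'b) monoid_scheme \<Rightarrow> 'a set \<Rightarrow> bool" where
  "free_basis G S \<longleftrightarrow> S \<subseteq> carrier G \<and> generate G S = carrier G \<and>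
     (\<forall>w. w \<noteq> [] \<and> set w \<subseteq> S \<times> UNIV \<and> reduced_word w \<longrightarrow> word_val G w \<noteq> \<one>\<^bsub>G\<^esub>)"

definition free_group :: "('a, 'b) monoid_scheme \<Rightarrow> bool" where
  "free_group G \<longleftrightarrow> group G \<and> (\<exists>S. free_basis G S)"

definition finitely_generated_group :: "('a, 'b) monoid_scheme \<Rightarrow> bool" where
  "finitely_generated_group G \<longleftrightarrow>
     group G \<and> (\<exists>S. finite S \<and> S \<subseteq> carrier G \<and> generate G S = carrier G)"


section \<open>Centreless, LEF, LEF-separated\<close>

definition group_centre :: "('a, 'b) monoid_scheme \<Rightarrow> 'a set" where
  "group_centre G = {z \<in> carrier G. \<forall>g \<in> carrier G. z \<otimes>\<^bsub>G\<^esub> g = g \<otimes>\<^bsub>G\<^esub> z}"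

definition centreless :: "('a, 'b) monoid_scheme \<Rightarrow> bool" where
  "centreless G \<longleftrightarrow> group_centre G = {\<one>\<^bsub>G\<^esub>}"

text \<open>
  Here and below, finite groups are taken on carriers of type \<open>nat\<close>; every finite group is
  isomorphic to one of these.
\<close>

definition lef_group :: "('a, 'b) monoid_scheme \<Rightarrow> bool" where
  "lef_group P \<longleftrightarrow> group P \<and>
     (\<forall>D. finite D \<and> D \<subseteq> carrier P \<longrightarrow>
        (\<exists>(C :: nat monoid) \<phi>. group C \<and> finite (carrier C) \<and>
           \<phi> \<in> D \<rightarrow> carrier C \<and> inj_on \<phi> D \<and>
           (\<forall>h\<in>D. \<forall>g\<in>D. h \<otimes>\<^bsub>P\<^esub> g \<in> D \<longrightarrow> \<phi> (h \<otimes>\<^bsub>P\<^esub> g) = \<phi> h \<otimes>\<^bsub>C\<^esub> \<phi> g)))"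

text \<open>
  \<open>lef_separated F N N1\<close> expresses that \<open>N1/N\<close> is LEF-separated in \<open>F/N\<close>; the notion refers to
  the presentation of the quotient. The inclusion below covers both \<open>\<phi>(D1) = {e}\<close> and \<open>D1 = {}\<close>.
\<close>

definition lef_separated :: "('a, 'b) monoid_scheme \<Rightarrow> 'a set \<Rightarrow> 'a set \<Rightarrow> bool" where
  "lef_separated F N N1 \<longleftrightarrow>
     (\<forall>D1 D2. finite D1 \<and> D1 \<subseteq> N \<and> finite D2 \<and> D2 \<subseteq> carrier F - N \<longrightarrow>
        (\<exists>(C :: nat monoid) \<phi>. group C \<and> finite (carrier C) \<and> \<phi> \<in> hom F C \<and>
           \<phi> ` D1 \<subseteq> {\<one>\<^bsub>C\<^esub>} \<and> \<one>\<^bsub>C\<^esub> \<notin> \<phi> ` D2 \<and> \<phi> ` (D2 - N1) \<inter> \<phi> ` N1 = {}))"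


section \<open>Pseudo length functions\<close>

definition invariant_pseudo_length :: "('a, 'b) monoid_scheme \<Rightarrow> ('a \<Rightarrow> real) \<Rightarrow> bool" where
  "invariant_pseudo_length G l \<longleftrightarrow>
     (\<forall>g\<in>carrier G. 0 \<le> l g) \<and> l \<one>\<^bsub>G\<^esub> = 0 \<and>
     (\<forall>g\<in>carrier G. l (inv\<^bsub>G\<^esub> g) = l g) \<and>
     (\<forall>g\<in>carrier G. \<forall>h\<in>carrier G. l (g \<otimes>\<^bsub>G\<^esub> h) \<le> l g + l h) \<and>
     (\<forall>g\<in>carrier G. \<forall>h\<in>carrier G. l (inv\<^bsub>G\<^esub> h \<otimes>\<^bsub>G\<^esub> g \<otimes>\<^bsub>G\<^esub> h) = l g)"

definition conj_class :: "('a, 'b) monoid_scheme \<Rightarrow> 'a \<Rightarrow> 'a set" where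
  "conj_class G g = (\<lambda>h. inv\<^bsub>G\<^esub> h \<otimes>\<^bsub>G\<^esub> g \<otimes>\<^bsub>G\<^esub> h) ` carrier G"

text \<open>For the trivial group the quotient is \<open>0 / 0 = 0\<close>, in accordance with \<open>l \<one> = 0\<close>.\<close>

definition conj_length :: "('a, 'b) monoid_scheme \<Rightarrow> 'a \<Rightarrow> real" where
  "conj_length G g = ln (real (card (conj_class G g))) / ln (real (card (carrier G)))"

definition conj_length_star ::
    "('a, 'b) monoid_scheme \<Rightarrow> 'a set \<Rightarrow> nat \<Rightarrow> nat \<Rightarrow> 'a \<Rightarrow> real" where
  "conj_length_star G H s t g =
     (if g \<in> H then root s (conj_length G g) / (real t + 1) else 1)"


section \<open>Metric ultraproducts\<close>

definition ultrafilter_on :: "'i set \<Rightarrow> 'i filter \<Rightarrow> bool" where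
  "ultrafilter_on I \<Phi> \<longleftrightarrow> \<Phi> \<noteq> bot \<and> eventually (\<lambda>i. i \<in> I) \<Phi> \<and>
     (\<forall>A. eventually (\<lambda>i. i \<in> A) \<Phi> \<or> eventually (\<lambda>i. i \<notin> A) \<Phi>)"

definition null_subgroup ::
    "'i set \<Rightarrow> 'i filter \<Rightarrow> ('i \<Rightarrow> ('a, 'b) monoid_scheme) \<Rightarrow> ('i \<Rightarrow> 'a \<Rightarrow> real) \<Rightarrow> ('i \<Rightarrow> 'a) set" where
  "null_subgroup I \<Phi> G l =
     {x \<in> carrier (product_group I G). ((\<lambda>i. l i (x i)) \<longlongrightarrow> 0) \<Phi>}"

definition metric_ultraproduct ::
    "'i set \<Rightarrow> 'i filter \<Rightarrow> ('i \<Rightarrow> ('a, 'b) monoid_scheme) \<Rightarrow> ('i \<Rightarrow> 'a \<Rightarrow> real) \<Rightarrow>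
      ('i \<Rightarrow> 'a) set monoid" where
  "metric_ultraproduct I \<Phi> G l = product_group I G Mod null_subgroup I \<Phi> G l"

text \<open>The norm of a coset is the common ultralimit of the lengths of its representatives.\<close>

definition ultraproduct_norm :: "'i filter \<Rightarrow> ('i \<Rightarrow> 'a \<Rightarrow> real) \<Rightarrow> ('i \<Rightarrow> 'a) set \<Rightarrow> real" where
  "ultraproduct_norm \<Phi> l X = (THE r. \<forall>x\<in>X. ((\<lambda>i. l i (x i)) \<longlongrightarrow> r) \<Phi>)"


section \<open>Well-definedness\<close>

lemma conj_class_subset:
  fixes G (structure)
  assumes "group G" "g \<in> carrier G"
  shows "conj_class G g \<subseteq> carrier G" "g \<in> conj_class G g"
proof -
  interpret group G by fact
  show "conj_class G g \<subseteq> carrier G"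
    unfolding conj_class_def by (rule image_subsetI) (simp add: assms(2))
  have "inv \<one> \<otimes> g \<otimes> \<one> \<in> conj_class G g"
    unfolding conj_class_def by (rule imageI) simp
  then show "g \<in> conj_class G g" using assms(2) by simp
qed

lemma conj_class_inv:
  fixes G (structure)
  assumes "group G" "g \<in> carrier G"
  shows "conj_class G (inv\<^bsub>G\<^esub> g) = (\<lambda>x. inv\<^bsub>G\<^esub> x) ` conj_class G g"
proof -
  interpret group G by fact
  show ?thesis unfolding conj_class_def image_image
    using assms by (intro image_cong) (auto simp: inv_mult_group m_assoc)
qed

lemma conj_class_conj:
  fixes G (structure)
  assumes "group G" "g \<in> carrier G" "h \<in> carrier G"
  shows "conj_class G (inv\<^bsub>G\<^esub> h \<otimes>\<^bsub>G\<^esub> g \<otimes>\<^bsub>G\<^esub> h) = conj_class G g"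
proof -
  interpret group G by fact
  have cancel: "a \<otimes> (inv a \<otimes> b) = b" if "a \<in> carrier G" "b \<in> carrier G" for a b
    using that by (simp flip: m_assoc)
  have sub: "conj_class G (inv k \<otimes> a \<otimes> k) \<subseteq> conj_class G a"
    if "a \<in> carrier G" "k \<in> carrier G" for a k
  proof
    fix x assume "x \<in> conj_class G (inv k \<otimes> a \<otimes> k)"
    then obtain b where "b \<in> carrier G" "x = inv b \<otimes> (inv k \<otimes> a \<otimes> k) \<otimes> b"
      by (auto simp: conj_class_def)
    then have "x = inv (k \<otimes> b) \<otimes> a \<otimes> (k \<otimes> b)" using that by (simp add: inv_mult_group m_assoc)
    then show "x \<in> conj_class G a" using that \<open>b \<in> carrier G\<close> by (auto simp: conj_class_def)
  qed
  have "g = inv (inv h) \<otimes> (inv h \<otimes> g \<otimes> h) \<otimes> inv h"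
    using assms by (simp add: m_assoc cancel)
  then have "conj_class G g \<subseteq> conj_class G (inv h \<otimes> g \<otimes> h)"
    using sub[of "inv h \<otimes> g \<otimes> h" "inv h"] assms by simp
  with sub[of g h] assms show ?thesis by blast
qed

lemma card_conj_class_mult:
  fixes G (structure)
  assumes "group G" "finite (carrier G)" "g \<in> carrier G" "h \<in> carrier G"
  shows "card (conj_class G (g \<otimes>\<^bsub>G\<^esub> h)) \<le> card (conj_class G g) * card (conj_class G h)"
proof -
  interpret group G by fact
  have cancel: "a \<otimes> (inv a \<otimes> b) = b" if "a \<in> carrier G" "b \<in> carrier G" for a b
    using that by (simp flip: m_assoc)
  have "conj_class G (g \<otimes> h) \<subseteq> (\<lambda>(x, y). x \<otimes> y) ` (conj_class G g \<times> conj_class G h)"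
  proof
    fix x assume "x \<in> conj_class G (g \<otimes> h)"
    then obtain k where k: "k \<in> carrier G" "x = inv k \<otimes> (g \<otimes> h) \<otimes> k"
      by (auto simp: conj_class_def)
    then have "x = (inv k \<otimes> g \<otimes> k) \<otimes> (inv k \<otimes> h \<otimes> k)" using assms by (simp add: m_assoc cancel)
    then show "x \<in> (\<lambda>(x, y). x \<otimes> y) ` (conj_class G g \<times> conj_class G h)"
      using k(1) by (auto simp: conj_class_def)
  qed
  moreover have fin: "finite (conj_class G g \<times> conj_class G h)"
    using assms(2) by (simp add: conj_class_def)
  ultimately have "card (conj_class G (g \<otimes> h)) \<le> card (conj_class G g \<times> conj_class G h)"
    by (rule order_trans[OF card_mono[OF finite_imageI] card_image_le, rotated]) (rule fin)+
  then show ?thesis by (simp add: card_cartesian_product)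
qed

lemma card_conj_class:
  assumes "group G" "finite (carrier G)" "g \<in> carrier G"
  shows "1 \<le> card (conj_class G g)" "card (conj_class G g) \<le> card (carrier G)"
proof -
  note c = conj_class_subset[OF assms(1,3)]
  have fin: "finite (conj_class G g)" using c(1) assms(2) by (rule finite_subset)
  then have "card (conj_class G g) \<noteq> 0" using c(2) by (metis card_0_eq empty_iff)
  then show "1 \<le> card (conj_class G g)" by simp
  show "card (conj_class G g) \<le> card (carrier G)" using assms(2) c(1) by (rule card_mono)
qed

lemma conj_length_nonneg:
  assumes "group G" "finite (carrier G)" "g \<in> carrier G"
  shows "0 \<le> conj_length G g"
  using card_conj_class[OF assms] unfolding conj_length_def
  by (intro divide_nonneg_nonneg ln_ge_zero) simp_all

lemma conj_length_le_1:
  assumes "group G" "finite (carrier G)" "g \<in> carrier G"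
  shows "conj_length G g \<le> 1"
proof -
  note c = card_conj_class[OF assms]
  have le: "ln (real (card (conj_class G g))) \<le> ln (real (card (carrier G)))"
    using c by (subst ln_le_cancel_iff) linarith+
  have nonneg: "0 \<le> ln (real (card (carrier G)))"
    using c by (intro ln_ge_zero) linarith
  show ?thesis
  proof (cases "ln (real (card (carrier G))) = 0")
    case False
    then have "0 < ln (real (card (carrier G)))" using nonneg by linarith
    then show ?thesis unfolding conj_length_def using le by (subst pos_divide_le_eq) simp_all
  qed (simp add: conj_length_def)
qed

lemma invariant_pseudo_length_conj_length:
  fixes G (structure)
  assumes "group G" "finite (carrier G)"
  shows "invariant_pseudo_length G (conj_length G)"
proof -
  interpret group G by fact
  have "conj_class G \<one> = {\<one>}" by (auto simp: conj_class_def)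
  then have one: "conj_length G \<one> = 0" by (simp add: conj_length_def)
  have inv: "conj_length G (inv g) = conj_length G g" if "g \<in> carrier G" for g
  proof -
    have "inj_on (\<lambda>x. inv x) (conj_class G g)"
      using conj_class_subset[OF assms(1) that] inv_inj by (meson inj_on_subset)
    then show ?thesis using that
      by (simp add: conj_length_def conj_class_inv[OF assms(1)] card_image)
  qed
  have tri: "conj_length G (g \<otimes> h) \<le> conj_length G g + conj_length G h"
    if gh: "g \<in> carrier G" "h \<in> carrier G" for g h
  proof -
    note c = card_conj_class[OF assms gh(1)] card_conj_class[OF assms gh(2)]
      card_conj_class[OF assms, of "g \<otimes> h"]
    have "real (card (conj_class G (g \<otimes> h)))
        \<le> real (card (conj_class G g)) * real (card (conj_class G h))"
      using card_conj_class_mult[OF assms gh] by (metis of_nat_le_iff of_nat_mult)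
    then have "ln (real (card (conj_class G (g \<otimes> h))))
        \<le> ln (real (card (conj_class G g)) * real (card (conj_class G h)))"
      using c gh by (subst ln_le_cancel_iff) auto
    also have "\<dots> = ln (real (card (conj_class G g))) + ln (real (card (conj_class G h)))"
      using c gh by (intro ln_mult_pos) auto
    finally have "ln (real (card (conj_class G (g \<otimes> h))))
        \<le> ln (real (card (conj_class G g))) + ln (real (card (conj_class G h)))" .
    moreover have "0 \<le> ln (real (card (carrier G)))"
      using c by (intro ln_ge_zero) simp
    ultimately show ?thesis unfolding conj_length_def
      by (metis add_divide_distrib divide_right_mono)
  qed
  show ?thesis unfolding invariant_pseudo_length_def
    using conj_length_nonneg[OF assms] one inv tri conj_class_conj[OF assms(1)]
    by (auto simp: conj_length_def)
qed

lemma root_add_le: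
  fixes a b :: real
  assumes "0 < n" "0 \<le> a" "0 \<le> b"
  shows "root n (a + b) \<le> root n a + root n b"
proof -
  have pow: "x ^ Suc m + y ^ Suc m \<le> (x + y) ^ Suc m" if "0 \<le> x" "0 \<le> y" for x y :: real and m
  proof (induction m)
    case (Suc m)
    have "x ^ Suc (Suc m) + y ^ Suc (Suc m) \<le> (x + y) * (x ^ Suc m + y ^ Suc m)"
      using that by (simp add: algebra_simps)
    also have "\<dots> \<le> (x + y) * (x + y) ^ Suc m"
      using Suc that by (intro mult_left_mono) auto
    finally show ?case by simp
  qed simp
  obtain m where m: "n = Suc m" using assms gr0_implies_Suc by blast
  have "a + b = root n a ^ n + root n b ^ n" using assms by simp
  also have "\<dots> \<le> (root n a + root n b) ^ n" using pow assms m by simp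
  finally have "root n (a + b) \<le> root n ((root n a + root n b) ^ n)" using assms by simp
  also have "\<dots> = root n a + root n b" using assms by (simp add: real_root_power_cancel)
  finally show ?thesis .
qed

lemma conj_length_star_bounds:
  assumes "group G" "finite (carrier G)" "1 \<le> s" "g \<in> carrier G"
  shows "0 \<le> conj_length_star G H s t g" "conj_length_star G H s t g \<le> 1"
proof -
  have "0 \<le> root s (conj_length G g)" "root s (conj_length G g) \<le> 1"
    using conj_length_nonneg[OF assms(1,2,4)] conj_length_le_1[OF assms(1,2,4)] assms(3)
    by auto
  then show "0 \<le> conj_length_star G H s t g" "conj_length_star G H s t g \<le> 1"
    by (auto simp: conj_length_star_def divide_le_eq_1 add_increasing)
qed

lemma invariant_pseudo_length_conj_length_star:
  fixes G (structure)
  assumes "group G" "finite (carrier G)" "H \<lhd> G" "1 \<le> s" "1 \<le> t"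
  shows "invariant_pseudo_length G (conj_length_star G H s t)"
proof -
  interpret group G by fact
  have cancel: "a \<otimes> (inv a \<otimes> b) = b" if "a \<in> carrier G" "b \<in> carrier G" for a b
    using that by (simp flip: m_assoc)
  interpret H: normal H G by fact
  let ?l = "conj_length_star G H s t"
  note ips = invariant_pseudo_length_conj_length[OF assms(1,2), unfolded invariant_pseudo_length_def]
  note bd = conj_length_star_bounds[OF assms(1,2,4), of _ H t]
  have inv_mem: "inv g \<in> H \<longleftrightarrow> g \<in> H" if "g \<in> carrier G" for g
    using that H.m_inv_closed inv_inv by metis
  have conj_mem: "inv h \<otimes> g \<otimes> h \<in> H \<longleftrightarrow> g \<in> H" if "g \<in> carrier G" "h \<in> carrier G" for g h
  proof
    assume "inv h \<otimes> g \<otimes> h \<in> H"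
    then have "h \<otimes> (inv h \<otimes> g \<otimes> h) \<otimes> inv h \<in> H" using H.inv_op_closed2 that by blast
    then show "g \<in> H" using that by (simp add: m_assoc cancel)
  next
    assume "g \<in> H" then show "inv h \<otimes> g \<otimes> h \<in> H" using H.inv_op_closed1 that by blast
  qed
  have tri: "?l (g \<otimes> h) \<le> ?l g + ?l h" if gh: "g \<in> carrier G" "h \<in> carrier G" for g h
  proof (cases "g \<in> H \<and> h \<in> H")
    case True
    have "root s (conj_length G (g \<otimes> h)) \<le> root s (conj_length G g + conj_length G h)"
      using ips gh assms(4) by simp
    also have "\<dots> \<le> root s (conj_length G g) + root s (conj_length G h)"
      using root_add_le ips gh assms(4) by simp
    finally show ?thesis using True assms(5)
      by (simp add: conj_length_star_def divide_right_mono flip: add_divide_distrib)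
  next
    case False
    then have "?l g = 1 \<or> ?l h = 1" by (auto simp: conj_length_star_def)
    then show ?thesis using bd[OF gh(1)] bd[OF gh(2)] bd[of "g \<otimes> h"] gh by auto
  qed
  show ?thesis unfolding invariant_pseudo_length_def
    using bd(1) tri ips inv_mem conj_mem H.one_closed assms(4)
    by (auto simp: conj_length_star_def)
qed

lemma ultrafilter_bounded_tendsto:
  fixes f :: "'i \<Rightarrow> real"
  assumes "ultrafilter_on I \<Phi>" "\<And>i. i \<in> I \<Longrightarrow> f i \<in> {a..b}"
  shows "\<exists>r. (f \<longlongrightarrow> r) \<Phi>"
proof -
  note uf = assms(1)[unfolded ultrafilter_on_def]
  show ?thesis
  proof (rule ccontr)
    assume no: "\<nexists>r. (f \<longlongrightarrow> r) \<Phi>"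
    have "\<exists>S. open S \<and> r \<in> S \<and> eventually (\<lambda>i. f i \<notin> S) \<Phi>" for r
    proof -
      obtain S where S: "open S" "r \<in> S" "\<not> eventually (\<lambda>i. f i \<in> S) \<Phi>"
        using no unfolding tendsto_def by blast
      have "eventually (\<lambda>i. i \<in> f -` S) \<Phi> \<or> eventually (\<lambda>i. i \<notin> f -` S) \<Phi>"
        using uf by blast
      then show ?thesis using S by auto
    qed
    then obtain S where S: "\<And>r. open (S r)" "\<And>r. r \<in> S r"
        "\<And>r. eventually (\<lambda>i. f i \<notin> S r) \<Phi>" by metis
    obtain C where C: "finite C" "{a..b} \<subseteq> (\<Union>r\<in>C. S r)"
      by (rule compactE_image[OF compact_Icc, of "{a..b}" S a b]) (use S in auto)
    have "eventually (\<lambda>i. \<forall>r\<in>C. f i \<notin> S r) \<Phi>"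
      using C(1) S(3) by (simp add: eventually_ball_finite)
    moreover have "eventually (\<lambda>i. i \<in> I) \<Phi>" using uf by blast
    ultimately have "eventually (\<lambda>_. False) \<Phi>"
      by eventually_elim (use assms(2) C(2) in blast)
    then show False using uf by simp
  qed
qed

lemma null_subgroup_normal:
  assumes uf: "ultrafilter_on I \<Phi>" and G: "\<And>i. i \<in> I \<Longrightarrow> group (G i)"
    and l: "\<And>i. i \<in> I \<Longrightarrow> invariant_pseudo_length (G i) (l i)"
  shows "null_subgroup I \<Phi> G l \<lhd> product_group I G"
proof -
  let ?P = "product_group I G"
  interpret P: group ?P using G by simp
  have I: "eventually (\<lambda>i. i \<in> I) \<Phi>" using uf by (simp add: ultrafilter_on_def)
  have mem: "x i \<in> carrier (G i)" if "x \<in> carrier ?P" "i \<in> I" for x i using that by auto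
  have "subgroup (null_subgroup I \<Phi> G l) ?P"
  proof (rule P.subgroupI)
    show "null_subgroup I \<Phi> G l \<subseteq> carrier ?P" by (auto simp: null_subgroup_def)
    have "eventually (\<lambda>i. l i (\<one>\<^bsub>?P\<^esub> i) = 0) \<Phi>"
      using I by eventually_elim (use l in \<open>auto simp: invariant_pseudo_length_def\<close>)
    then have "((\<lambda>i. l i (\<one>\<^bsub>?P\<^esub> i)) \<longlongrightarrow> 0) \<Phi>" by (rule tendsto_eventually)
    then show "null_subgroup I \<Phi> G l \<noteq> {}"
      unfolding null_subgroup_def using P.one_closed by blast
  next
    fix x assume x: "x \<in> null_subgroup I \<Phi> G l"
    then have xc: "x \<in> carrier ?P" by (simp add: null_subgroup_def)
    have "eventually (\<lambda>i. l i ((inv\<^bsub>?P\<^esub> x) i) = l i (x i)) \<Phi>" using I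
    proof eventually_elim
      case (elim i)
      have "(inv\<^bsub>?P\<^esub> x) i = inv\<^bsub>G i\<^esub> (x i)" using xc G elim by simp
      then show ?case using l[OF elim] mem[OF xc elim] by (simp add: invariant_pseudo_length_def)
    qed
    moreover have "((\<lambda>i. l i (x i)) \<longlongrightarrow> 0) \<Phi>" using x by (simp add: null_subgroup_def)
    ultimately have "((\<lambda>i. l i ((inv\<^bsub>?P\<^esub> x) i)) \<longlongrightarrow> 0) \<Phi>" using tendsto_cong by fast
    then show "inv\<^bsub>?P\<^esub> x \<in> null_subgroup I \<Phi> G l"
      unfolding null_subgroup_def using P.inv_closed[OF xc] by blast
  next
    fix x y assume x: "x \<in> null_subgroup I \<Phi> G l" and y: "y \<in> null_subgroup I \<Phi> G l"
    then have c: "x \<in> carrier ?P" "y \<in> carrier ?P" by (auto simp: null_subgroup_def)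
    have "((\<lambda>i. l i (x i) + l i (y i)) \<longlongrightarrow> 0 + 0) \<Phi>"
      using x y by (intro tendsto_add) (auto simp: null_subgroup_def)
    then have s: "((\<lambda>i. l i (x i) + l i (y i)) \<longlongrightarrow> 0) \<Phi>" by simp
    have b: "0 \<le> l i ((x \<otimes>\<^bsub>?P\<^esub> y) i) \<and> l i ((x \<otimes>\<^bsub>?P\<^esub> y) i) \<le> l i (x i) + l i (y i)"
      if i: "i \<in> I" for i
      using l[OF i] mem[OF c(1) i] mem[OF c(2) i] i group.is_monoid[OF G[OF i]]
      by (auto simp: invariant_pseudo_length_def monoid.m_closed)
    have "((\<lambda>i. l i ((x \<otimes>\<^bsub>?P\<^esub> y) i)) \<longlongrightarrow> 0) \<Phi>"
      by (rule tendsto_sandwich[OF _ _ tendsto_const s])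
        (use I b in \<open>auto elim!: eventually_mono simp del: mult_product_group\<close>)
    then show "x \<otimes>\<^bsub>?P\<^esub> y \<in> null_subgroup I \<Phi> G l"
      unfolding null_subgroup_def using P.m_closed[OF c] by blast
  qed
  moreover have "x \<otimes>\<^bsub>?P\<^esub> h \<otimes>\<^bsub>?P\<^esub> inv\<^bsub>?P\<^esub> x \<in> null_subgroup I \<Phi> G l"
    if x: "x \<in> carrier ?P" and h: "h \<in> null_subgroup I \<Phi> G l" for x h
  proof -
    have hc: "h \<in> carrier ?P" using h by (simp add: null_subgroup_def)
    have "eventually (\<lambda>i. l i ((x \<otimes>\<^bsub>?P\<^esub> h \<otimes>\<^bsub>?P\<^esub> inv\<^bsub>?P\<^esub> x) i) = l i (h i)) \<Phi>" using I
    proof eventually_elim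
      case (elim i)
      interpret Gi: group "G i" using G elim .
      have "l i (inv\<^bsub>G i\<^esub> (inv\<^bsub>G i\<^esub> x i) \<otimes>\<^bsub>G i\<^esub> h i \<otimes>\<^bsub>G i\<^esub> inv\<^bsub>G i\<^esub> x i) = l i (h i)"
        using l[OF elim] mem[OF x elim] mem[OF hc elim] Gi.inv_closed
        unfolding invariant_pseudo_length_def by blast
      moreover have "(x \<otimes>\<^bsub>?P\<^esub> h \<otimes>\<^bsub>?P\<^esub> inv\<^bsub>?P\<^esub> x) i = x i \<otimes>\<^bsub>G i\<^esub> h i \<otimes>\<^bsub>G i\<^esub> inv\<^bsub>G i\<^esub> x i"
        using x G elim by simp
      ultimately show ?case using mem[OF x elim] by simp
    qed
    moreover have "((\<lambda>i. l i (h i)) \<longlongrightarrow> 0) \<Phi>" using h by (simp add: null_subgroup_def)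
    ultimately have "((\<lambda>i. l i ((x \<otimes>\<^bsub>?P\<^esub> h \<otimes>\<^bsub>?P\<^esub> inv\<^bsub>?P\<^esub> x) i)) \<longlongrightarrow> 0) \<Phi>"
      using tendsto_cong by fast
    then show ?thesis
      unfolding null_subgroup_def using P.m_closed P.inv_closed x hc by blast
  qed
  ultimately show ?thesis by (simp add: P.normal_inv_iff del: carrier_product_group)
qed

lemma group_metric_ultraproduct:
  assumes "ultrafilter_on I \<Phi>" "\<And>i. i \<in> I \<Longrightarrow> group (G i)"
    and "\<And>i. i \<in> I \<Longrightarrow> invariant_pseudo_length (G i) (l i)"
  shows "group (metric_ultraproduct I \<Phi> G l)"
  unfolding metric_ultraproduct_def
  using null_subgroup_normal[of I \<Phi> G l] assms by (simp add: normal.factorgroup_is_group)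

lemma invariant_pseudo_length_mult:
  assumes "invariant_pseudo_length G l" "g \<in> carrier G" "h \<in> carrier G"
  shows "l (g \<otimes>\<^bsub>G\<^esub> h) \<le> l g + l h"
  using assms by (simp add: invariant_pseudo_length_def)

lemma invariant_pseudo_length_inv:
  assumes "invariant_pseudo_length G l" "g \<in> carrier G"
  shows "l (inv\<^bsub>G\<^esub> g) = l g"
  using assms by (simp add: invariant_pseudo_length_def)

lemma ultraproduct_norm_eq:
  assumes uf: "ultrafilter_on I \<Phi>" and G: "\<And>i. i \<in> I \<Longrightarrow> group (G i)"
    and l: "\<And>i. i \<in> I \<Longrightarrow> invariant_pseudo_length (G i) (l i)"
    and bd: "\<And>i g. i \<in> I \<Longrightarrow> g \<in> carrier (G i) \<Longrightarrow> l i g \<le> c"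
    and x: "x \<in> carrier (product_group I G)"
  shows "((\<lambda>i. l i (x i)) \<longlongrightarrow>
      ultraproduct_norm \<Phi> l (null_subgroup I \<Phi> G l #>\<^bsub>product_group I G\<^esub> x)) \<Phi>"
proof -
  let ?P = "product_group I G"
  let ?X = "null_subgroup I \<Phi> G l #>\<^bsub>?P\<^esub> x"
  interpret P: group ?P using G by simp
  interpret N: normal "null_subgroup I \<Phi> G l" ?P
    by (rule null_subgroup_normal[OF uf G l])
  have I: "eventually (\<lambda>i. i \<in> I) \<Phi>" "\<Phi> \<noteq> bot" using uf by (auto simp: ultrafilter_on_def)
  have mem: "y i \<in> carrier (G i)" if "y \<in> carrier ?P" "i \<in> I" for y i using that by auto
  have bdd: "l i (x i) \<in> {0..c}" if "i \<in> I" for i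
    using l[OF that] bd[OF that] mem[OF x that] by (auto simp: invariant_pseudo_length_def)
  have "\<exists>r. ((\<lambda>i. l i (x i)) \<longlongrightarrow> r) \<Phi>"
    by (rule ultrafilter_bounded_tendsto[OF uf]) (rule bdd)
  then obtain r where r: "((\<lambda>i. l i (x i)) \<longlongrightarrow> r) \<Phi>" by (rule exE)
  have all: "((\<lambda>i. l i (y i)) \<longlongrightarrow> r) \<Phi>" if "y \<in> ?X" for y
  proof -
    have "\<exists>n\<in>null_subgroup I \<Phi> G l. y = n \<otimes>\<^bsub>?P\<^esub> x"
      using that by (simp add: r_coset_def del: mult_product_group)
    then obtain n where n: "n \<in> null_subgroup I \<Phi> G l" "y = n \<otimes>\<^bsub>?P\<^esub> x" by (rule bexE)
    have nc: "n \<in> carrier ?P" using n by (simp add: null_subgroup_def)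
    have n0: "((\<lambda>i. l i (n i)) \<longlongrightarrow> 0) \<Phi>" using n by (simp add: null_subgroup_def)
    have b: "l i (x i) - l i (n i) \<le> l i (y i) \<and> l i (y i) \<le> l i (n i) + l i (x i)"
      if i: "i \<in> I" for i
    proof -
      interpret Gi: group "G i" using G i .
      have m: "n i \<in> carrier (G i)" "x i \<in> carrier (G i)"
        by (rule mem[OF nc i], rule mem[OF x i])
      have y: "y i = n i \<otimes>\<^bsub>G i\<^esub> x i" using n i by simp
      note tri = invariant_pseudo_length_mult[OF l[OF i]]
      have yc: "y i \<in> carrier (G i)" using m by (simp add: y)
      have "inv\<^bsub>G i\<^esub> n i \<otimes>\<^bsub>G i\<^esub> y i = x i" using m by (simp add: y flip: Gi.m_assoc)
      then have "l i (x i) \<le> l i (inv\<^bsub>G i\<^esub> n i) + l i (y i)"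
        using tri[OF Gi.inv_closed[OF m(1)] yc] by (rule subst)
      moreover have "l i (inv\<^bsub>G i\<^esub> n i) = l i (n i)"
        by (rule invariant_pseudo_length_inv[OF l[OF i] m(1)])
      ultimately show ?thesis using tri[OF m] unfolding y by linarith
    qed
    have lim: "((\<lambda>i. l i (x i) - l i (n i)) \<longlongrightarrow> r) \<Phi>" "((\<lambda>i. l i (n i) + l i (x i)) \<longlongrightarrow> r) \<Phi>"
      using tendsto_diff[OF r n0] tendsto_add[OF n0 r] by simp_all
    show ?thesis
    proof (rule tendsto_sandwich[OF _ _ lim])
      show "eventually (\<lambda>i. l i (x i) - l i (n i) \<le> l i (y i)) \<Phi>"
        using I(1) by (rule eventually_mono) (rule b[THEN conjunct1])
      show "eventually (\<lambda>i. l i (y i) \<le> l i (n i) + l i (x i)) \<Phi>"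
        using I(1) by (rule eventually_mono) (rule b[THEN conjunct2])
    qed
  qed
  have xX: "x \<in> ?X" using P.rcos_self[OF x N.subgroup_axioms] .
  have "ultraproduct_norm \<Phi> l ?X = r" unfolding ultraproduct_norm_def
  proof (rule the_equality)
    show "\<forall>y\<in>?X. ((\<lambda>i. l i (y i)) \<longlongrightarrow> r) \<Phi>" using all by (rule ballI)
    show "q = r" if "\<forall>y\<in>?X. ((\<lambda>i. l i (y i)) \<longlongrightarrow> q) \<Phi>" for q
      by (rule tendsto_unique[OF I(2) bspec[OF that xX] r])
  qed
  then show ?thesis using r by simp
qed

end

theory Submission
  imports Defs "HOL-Algebra.Bij" "HOL-Algebra.Weak_Morphisms" "HOL-Library.Countable_Set"
begin

text \<open>
  A finitely generated group \<open>F\<close> is countable, so it is exhausted by finite sets \<open>E n\<close>. By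
  LEF-separation, for each \<open>n\<close> there is a homomorphism \<open>\<phi>\<close> from \<open>F\<close> to a finite group that kills \<open>E n \<inter> N\<close>,
  kills no element of \<open>E n - N\<close>, and sends no element of \<open>E n - N1\<close> into \<open>\<phi> ` N1\<close>. With \<open>\<phi> ` N1\<close> in the
  role of \<open>H\<close>, the length \<open>conj_length_star\<close> of \<open>\<phi> x\<close> is \<open>1\<close> for \<open>x \<in> E n - N1\<close>, at most \<open>1 / 2\<close> for
  \<open>x \<in> N1\<close>, and \<open>0\<close> for \<open>x \<in> E n \<inter> N\<close>. Along a nonprincipal ultrafilter every element of \<open>F\<close> is
  eventually treated correctly. Two points remain: the finite groups must be centreless, and the
  elements of \<open>N1 - N\<close> must not acquire norm \<open>0\<close>.

  The first point is settled by enlarging the finite group. Every finite group \<open>C\<close> is a retract of a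
  finite centreless group, namely of the wreath product of the symmetric group on three points by
  \<open>C\<close> (lemma \<open>finite_group_retract_of_centreless\<close>). Taking for \<open>H\<close> the preimage of \<open>\<phi> ` N1\<close> under the
  retraction, the separation properties survive (lemma \<open>lef_separated_centreless_quotient\<close>).

  This also prepares the second point. In a centreless group a nontrivial element has at least two
  conjugates, so its conjugacy length is positive, and a sufficiently high root of it is at least
  \<open>1 / 2\<close>. The exponent \<open>s\<close> is chosen for each finite group separately (lemma
  \<open>uniform_root_conj_length\<close>); with \<open>t = 1\<close>, the elements of \<open>N1 - N\<close> then have norm between \<open>1 / 4\<close> and
  \<open>1 / 2\<close>. So the kernel of the map from \<open>F\<close> to the ultraproduct is \<open>N\<close>, and the elements of norm at
  most \<open>1 / 2\<close> are those that come from \<open>N1\<close>.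
\<close>

section \<open>Ultrafilters and countability\<close>

text \<open>
  The ultrafilters are the minimal proper filters. A chain of proper filters has a proper infimum, since
  the sets that are large for the infimum are those that are large for some member of the chain; so
  Zorn's lemma gives a minimal filter below the given one. Applied to \<open>sequentially\<close>, it gives an
  ultrafilter on the natural numbers that contains every cofinite set.
\<close>

lemma ultrafilter_finer_than:
  fixes F0 :: "'i filter"
  assumes "F0 \<noteq> bot"
  obtains \<Phi> where "ultrafilter_on UNIV \<Phi>" "\<Phi> \<le> F0"
proof -
  let ?A = "{F. F \<noteq> bot \<and> F \<le> F0}"
  have "\<exists>\<Phi>\<in>?A. \<forall>F\<in>?A. F \<le> \<Phi> \<longrightarrow> F = \<Phi>"
  proof (rule predicate_Zorn)
    show "partial_order_on ?A (relation_of (\<lambda>a b. b \<le> a) ?A)"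
      by (rule partial_order_on_relation_ofI) auto
  next
    fix C assume "C \<in> Chains (relation_of (\<lambda>a b. b \<le> a) ?A)"
    then have C: "C \<subseteq> ?A" "\<And>a b. a \<in> C \<Longrightarrow> b \<in> C \<Longrightarrow> a \<le> b \<or> b \<le> a"
      by (auto simp: Chains_def relation_of_def)
    show "\<exists>u\<in>?A. \<forall>a\<in>C. u \<le> a"
    proof (cases "C = {}")
      case True
      then show ?thesis using assms by auto
    next
      case False
      then have "eventually P (Inf C) \<longleftrightarrow> (\<exists>b\<in>C. eventually P b)" for P
        using C(2) by (intro eventually_Inf_base) (auto simp: inf_absorb1 inf_absorb2)
      then have "Inf C \<noteq> bot"
        using C(1) by (auto simp: trivial_limit_def)
      moreover have "Inf C \<le> F0"
        using False C(1) Inf_lower2[of _ C F0] by blast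
      ultimately have "Inf C \<in> ?A" by blast
      then show ?thesis by (meson Inf_lower)
    qed
  qed
  then obtain \<Phi> where \<Phi>: "\<Phi> \<noteq> bot" "\<Phi> \<le> F0"
    and minimal: "\<And>F. F \<noteq> bot \<Longrightarrow> F \<le> F0 \<Longrightarrow> F \<le> \<Phi> \<Longrightarrow> F = \<Phi>"
    by blast
  have min: "F = \<Phi>" if "F \<noteq> bot" "F \<le> \<Phi>" for F
    using minimal[OF that(1) order_trans[OF that(2) \<Phi>(2)] that(2)] .
  have "eventually (\<lambda>i. i \<in> A) \<Phi> \<or> eventually (\<lambda>i. i \<notin> A) \<Phi>" for A
  proof (cases "inf \<Phi> (principal A) = bot")
    case True
    then show ?thesis by (simp add: trivial_limit_def eventually_inf_principal)
  next
    case False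
    then have "\<Phi> \<le> principal A" using min[of "inf \<Phi> (principal A)"] by (metis inf_le1 inf_le2)
    then show ?thesis by (simp add: le_principal)
  qed
  then have "ultrafilter_on UNIV \<Phi>" using \<Phi> by (auto simp: ultrafilter_on_def)
  then show ?thesis using that \<Phi> by blast
qed

text \<open>
  Every element of \<open>generate G S\<close> is the value of a word over \<open>S\<close>, and there are only countably many
  words. This allows a finitely generated group to be exhausted by a sequence of finite sets.
\<close>

lemma countable_generate:
  fixes G (structure)
  assumes "group G" "countable S" "S \<subseteq> carrier G"
  shows "countable (generate G S)"
proof -
  interpret group G by fact
  have letter: "letter_val G p \<in> carrier G" if "p \<in> S \<times> UNIV" for p
    using that assms(3) by (auto simp: letter_val_def)
  have val_closed: "word_val G w \<in> carrier G" if "w \<in> lists (S \<times> UNIV)" for w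
    using that by induction (auto simp: word_val_def letter)
  have val_append: "word_val G (v @ w) = word_val G v \<otimes> word_val G w"
    if "v \<in> lists (S \<times> UNIV)" "w \<in> lists (S \<times> UNIV)" for v w
    using that(1)
  proof induction
    case (Cons p v)
    then show ?case
      using letter[of p] val_closed[of v] val_closed[OF that(2)] by (simp add: word_val_def m_assoc)
  qed (use val_closed[OF that(2)] in \<open>simp add: word_val_def\<close>)
  have "x \<in> word_val G ` lists (S \<times> UNIV)" if "x \<in> generate G S" for x
    using that
  proof induction
    case one
    show ?case by (rule image_eqI[of _ _ "[]"]) (auto simp: word_val_def)
  next
    case (incl h)
    then show ?case using assms(3)
      by (intro image_eqI[of _ _ "[(h, True)]"]) (auto simp: word_val_def letter_val_def)
  next
    case (inv h)
    then show ?case using assms(3)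
      by (intro image_eqI[of _ _ "[(h, False)]"]) (auto simp: word_val_def letter_val_def)
  next
    case (eng h1 h2)
    then obtain v w where "v \<in> lists (S \<times> UNIV)" "w \<in> lists (S \<times> UNIV)"
      "h1 = word_val G v" "h2 = word_val G w" by blast
    then show ?case using val_append by (intro image_eqI[of _ _ "v @ w"]) auto
  qed
  then have "generate G S \<subseteq> word_val G ` lists (S \<times> UNIV)" by blast
  moreover have "countable (word_val G ` lists (S \<times> (UNIV :: bool set)))"
    using assms(2) by (intro countable_image countable_lists countable_SIGMA) auto
  ultimately show ?thesis by (rule countable_subset)
qed

section \<open>Transport of normality and centrelessness\<close>

lemma normal_hom_preimage:
  assumes "group G" "f \<in> hom G C" "M \<lhd> C"
  shows "{x \<in> carrier G. f x \<in> M} \<lhd> G"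
proof -
  interpret M: normal M C by fact
  interpret f: group_hom G C f
    using assms M.is_group by (simp add: group_hom_def group_hom_axioms_def)
  have "subgroup {x \<in> carrier G. f x \<in> M} G"
    by (rule f.G.subgroupI) (auto intro!: exI[of _ "\<one>\<^bsub>G\<^esub>"])
  then show ?thesis
    by (auto simp: f.G.normal_inv_iff M.inv_op_closed2)
qed

lemma centreless_iso:
  assumes "group G" "group H" "f \<in> iso G H" "centreless G"
  shows "centreless H"
proof -
  interpret f: group_hom G H f
    using assms by (simp add: group_hom_def group_hom_axioms_def iso_def)
  have surj: "f ` carrier G = carrier H" and inj: "inj_on f (carrier G)"
    using assms(3) by (auto simp: iso_def bij_betw_def)
  have "z = \<one>\<^bsub>H\<^esub>" if "z \<in> group_centre H" for z
  proof -
    have zH: "z \<in> carrier H" and comm: "\<And>g. g \<in> carrier H \<Longrightarrow> z \<otimes>\<^bsub>H\<^esub> g = g \<otimes>\<^bsub>H\<^esub> z"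
      using that by (auto simp: group_centre_def)
    obtain y where y: "y \<in> carrier G" "z = f y" using zH surj by blast
    have "y \<otimes>\<^bsub>G\<^esub> g = g \<otimes>\<^bsub>G\<^esub> y" if g: "g \<in> carrier G" for g
      by (rule inj_onD[OF inj]) (use comm[of "f g"] g y in simp_all)
    then have "y \<in> group_centre G" using y by (simp add: group_centre_def)
    then show ?thesis using assms(4) y by (simp add: centreless_def)
  qed
  moreover have "\<one>\<^bsub>H\<^esub> \<in> group_centre H" by (simp add: group_centre_def)
  ultimately show ?thesis unfolding centreless_def by blast
qed

section \<open>Finite groups as retracts of finite centreless groups\<close>

text \<open>
  The wreath product of the symmetric group on three points by a group \<open>C\<close> is realised as a
  permutation group. It acts on \<open>C\<close>-many blocks of three points, and consists of the permutations
  that move the blocks by a left translation of \<open>C\<close>. Three is the least block size for which the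
  symmetric group on a block is nontrivial and centreless.
\<close>

abbreviation block_points :: "('a, 'b) monoid_scheme \<Rightarrow> ('a \<times> nat) set" where
  "block_points C \<equiv> carrier C \<times> {..<3}"

definition block_perms :: "('a, 'b) monoid_scheme \<Rightarrow> ('a \<times> nat \<Rightarrow> 'a \<times> nat) set" where
  "block_perms C = {\<pi> \<in> Bij (block_points C).
     \<exists>k\<in>carrier C. \<forall>x\<in>block_points C. fst (\<pi> x) = k \<otimes>\<^bsub>C\<^esub> fst x}"

definition block_group :: "('a, 'b) monoid_scheme \<Rightarrow> ('a \<times> nat \<Rightarrow> 'a \<times> nat) monoid" where
  "block_group C = BijGroup (block_points C)\<lparr>carrier := block_perms C\<rparr>"

text \<open>
  The element of \<open>C\<close> by which a permutation translates the blocks can be read off from the image of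
  any point of the block of \<open>\<one>\<close>.
\<close>

definition block_shift :: "('a, 'b) monoid_scheme \<Rightarrow> ('a \<times> nat \<Rightarrow> 'a \<times> nat) \<Rightarrow> 'a" where
  "block_shift C \<pi> = fst (\<pi> (\<one>\<^bsub>C\<^esub>, 0))"

definition block_translation :: "('a, 'b) monoid_scheme \<Rightarrow> 'a \<Rightarrow> 'a \<times> nat \<Rightarrow> 'a \<times> nat" where
  "block_translation C c = (\<lambda>x\<in>block_points C. (c \<otimes>\<^bsub>C\<^esub> fst x, snd x))"

lemma BijGroup_mult_apply:
  assumes "f \<in> Bij S" "g \<in> Bij S" "x \<in> S"
  shows "(f \<otimes>\<^bsub>BijGroup S\<^esub> g) x = f (g x)"
  using assms by (simp add: BijGroup_def compose_eq)

lemma BijGroup_one_apply: "x \<in> S \<Longrightarrow> \<one>\<^bsub>BijGroup S\<^esub> x = x"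
  by (simp add: BijGroup_def)

lemma Bij_mem: "f \<in> Bij S \<Longrightarrow> x \<in> S \<Longrightarrow> f x \<in> S"
  using Bij_imp_funcset by blast

lemma Bij_ext:
  assumes "f \<in> Bij S" "g \<in> Bij S" "\<And>x. x \<in> S \<Longrightarrow> f x = g x"
  shows "f = g"
  using assms by (meson Bij_imp_extensional extensionalityI)

context
  fixes C :: "('a, 'b) monoid_scheme" (structure)
  assumes C: "group C"
begin

interpretation C: group C by (rule C)

lemma block_shift_eq:
  assumes "\<pi> \<in> block_perms C"
  shows "block_shift C \<pi> \<in> carrier C"
    and "\<And>x. x \<in> block_points C \<Longrightarrow> fst (\<pi> x) = block_shift C \<pi> \<otimes> fst x"
proof -
  obtain k where k: "k \<in> carrier C" "\<forall>x\<in>block_points C. fst (\<pi> x) = k \<otimes> fst x"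
    using assms by (auto simp: block_perms_def)
  then have "block_shift C \<pi> = k" by (simp add: block_shift_def)
  then show "block_shift C \<pi> \<in> carrier C"
    and "\<And>x. x \<in> block_points C \<Longrightarrow> fst (\<pi> x) = block_shift C \<pi> \<otimes> fst x" using k by auto
qed

lemma block_perms_Bij: "\<pi> \<in> block_perms C \<Longrightarrow> \<pi> \<in> Bij (block_points C)"
  by (simp add: block_perms_def)

lemma subgroup_block_perms: "subgroup (block_perms C) (BijGroup (block_points C))"
proof -
  interpret B: group "BijGroup (block_points C)" by (rule group_BijGroup)
  have carrier: "carrier (BijGroup (block_points C)) = Bij (block_points C)"
    by (simp add: BijGroup_def)
  show ?thesis
  proof (rule B.subgroupI)
    show "block_perms C \<subseteq> carrier (BijGroup (block_points C))" by (auto simp: carrier block_perms_def)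
    have "\<one>\<^bsub>BijGroup (block_points C)\<^esub> \<in> block_perms C"
      using B.one_closed
      by (auto simp: block_perms_def carrier BijGroup_one_apply intro!: bexI[of _ \<one>])
    then show "block_perms C \<noteq> {}" by blast
  next
    fix \<pi> \<sigma> assume \<pi>: "\<pi> \<in> block_perms C" and \<sigma>: "\<sigma> \<in> block_perms C"
    note Bij = block_perms_Bij[OF \<pi>] block_perms_Bij[OF \<sigma>]
    have "fst ((\<pi> \<otimes>\<^bsub>BijGroup (block_points C)\<^esub> \<sigma>) x) = (block_shift C \<pi> \<otimes> block_shift C \<sigma>) \<otimes> fst x"
      if x: "x \<in> block_points C" for x
      using x block_shift_eq[OF \<pi>] block_shift_eq[OF \<sigma>] Bij_mem[OF Bij(2) x]
      by (auto simp: BijGroup_mult_apply[OF Bij x] C.m_assoc)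
    then show "\<pi> \<otimes>\<^bsub>BijGroup (block_points C)\<^esub> \<sigma> \<in> block_perms C"
      using B.m_closed Bij block_shift_eq(1)[OF \<pi>] block_shift_eq(1)[OF \<sigma>]
      unfolding block_perms_def carrier by blast
  next
    fix \<pi> assume \<pi>: "\<pi> \<in> block_perms C"
    note Bij = block_perms_Bij[OF \<pi>]
    let ?\<rho> = "inv\<^bsub>BijGroup (block_points C)\<^esub> \<pi>"
    have \<rho>: "?\<rho> \<in> Bij (block_points C)" using B.inv_closed Bij by (simp add: carrier)
    have "fst (?\<rho> x) = inv (block_shift C \<pi>) \<otimes> fst x" if x: "x \<in> block_points C" for x
    proof -
      have "\<pi> (?\<rho> x) = x"
        using BijGroup_mult_apply[OF Bij \<rho> x] Bij x B.r_inv[of \<pi>]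
        by (simp add: carrier BijGroup_one_apply)
      then have "fst x = block_shift C \<pi> \<otimes> fst (?\<rho> x)"
        using block_shift_eq(2)[OF \<pi> Bij_mem[OF \<rho> x]] by simp
      then show ?thesis
        using block_shift_eq(1)[OF \<pi>] Bij_mem[OF \<rho> x] by (auto simp flip: C.m_assoc)
    qed
    then show "?\<rho> \<in> block_perms C"
      using \<rho> block_shift_eq(1)[OF \<pi>] unfolding block_perms_def by blast
  qed
qed

lemma group_block_group: "group (block_group C)"
  unfolding block_group_def
  by (rule subgroup.subgroup_is_group[OF subgroup_block_perms group_BijGroup])

lemma block_group_simps:
  "carrier (block_group C) = block_perms C"
  "\<pi> \<otimes>\<^bsub>block_group C\<^esub> \<sigma> = \<pi> \<otimes>\<^bsub>BijGroup (block_points C)\<^esub> \<sigma>"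
  "\<one>\<^bsub>block_group C\<^esub> = \<one>\<^bsub>BijGroup (block_points C)\<^esub>"
  by (simp_all add: block_group_def)

lemma finite_block_group:
  assumes "finite (carrier C)"
  shows "finite (carrier (block_group C))"
proof -
  have "block_perms C \<subseteq> (\<Pi>\<^sub>E x\<in>block_points C. block_points C)"
  proof
    fix \<pi> assume "\<pi> \<in> block_perms C"
    then have "\<pi> \<in> Bij (block_points C)" by (rule block_perms_Bij)
    then show "\<pi> \<in> (\<Pi>\<^sub>E x\<in>block_points C. block_points C)"
      by (simp only: PiE_def Int_iff Bij_imp_extensional Bij_imp_funcset simp_thms)
  qed
  moreover have "finite (\<Pi>\<^sub>E x\<in>block_points C. block_points C)"
    using assms by (intro finite_PiE) auto
  ultimately show ?thesis unfolding block_group_simps by (rule finite_subset)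
qed

lemma block_shift_hom: "block_shift C \<in> hom (block_group C) C"
proof (rule homI)
  fix \<pi> \<sigma> assume "\<pi> \<in> carrier (block_group C)" "\<sigma> \<in> carrier (block_group C)"
  then have \<pi>: "\<pi> \<in> block_perms C" and \<sigma>: "\<sigma> \<in> block_perms C" by (simp_all add: block_group_simps)
  have x: "(\<one>, 0) \<in> block_points C" by simp
  have "fst (\<pi> (\<sigma> (\<one>, 0))) = block_shift C \<pi> \<otimes> fst (\<sigma> (\<one>, 0))"
    by (rule block_shift_eq(2)[OF \<pi> Bij_mem[OF block_perms_Bij[OF \<sigma>] x]])
  then show "block_shift C (\<pi> \<otimes>\<^bsub>block_group C\<^esub> \<sigma>) = block_shift C \<pi> \<otimes> block_shift C \<sigma>"
    using BijGroup_mult_apply[OF block_perms_Bij[OF \<pi>] block_perms_Bij[OF \<sigma>] x]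
    by (simp add: block_group_simps block_shift_def)
qed (simp add: block_group_simps block_shift_eq)

lemma block_translation_mem:
  assumes "c \<in> carrier C"
  shows "block_translation C c \<in> block_perms C"
proof -
  have "bij_betw (block_translation C c) (block_points C) (block_points C)"
  proof (rule bij_betwI[where g = "\<lambda>x. (inv c \<otimes> fst x, snd x)"])
    show "block_translation C c \<in> block_points C \<rightarrow> block_points C"
      "(\<lambda>x. (inv c \<otimes> fst x, snd x)) \<in> block_points C \<rightarrow> block_points C"
      using assms by (auto simp: block_translation_def)
  qed (use assms in \<open>auto simp: block_translation_def simp flip: C.m_assoc\<close>)
  then have "block_translation C c \<in> Bij (block_points C)"
    by (simp add: Bij_def block_translation_def)
  then show ?thesis
    using assms by (auto simp: block_perms_def block_translation_def intro!: bexI[of _ c])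
qed

lemma block_translation_hom: "block_translation C \<in> hom C (block_group C)"
proof (rule homI)
  fix c d assume cd: "c \<in> carrier C" "d \<in> carrier C"
  note Bij = block_perms_Bij[OF block_translation_mem]
  have "(block_translation C c \<otimes>\<^bsub>BijGroup (block_points C)\<^esub> block_translation C d) x =
      block_translation C (c \<otimes> d) x"
    if x: "x \<in> block_points C" for x
    unfolding BijGroup_mult_apply[OF Bij[OF cd(1)] Bij[OF cd(2)] x]
    using x cd by (auto simp: block_translation_def C.m_assoc)
  moreover have "block_translation C c \<otimes>\<^bsub>BijGroup (block_points C)\<^esub> block_translation C d
      \<in> Bij (block_points C)"
    using subgroup.m_closed[OF subgroup_block_perms] block_translation_mem cd block_perms_Bij by blast
  ultimately show "block_translation C (c \<otimes> d) =
      block_translation C c \<otimes>\<^bsub>block_group C\<^esub> block_translation C d"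
    using Bij[of "c \<otimes> d"] cd by (intro Bij_ext[of _ "block_points C"]) (auto simp: block_group_simps)
qed (simp add: block_group_simps block_translation_mem)

lemma block_shift_translation: "c \<in> carrier C \<Longrightarrow> block_shift C (block_translation C c) = c"
  by (simp add: block_shift_def block_translation_def)

text \<open>
  A central \<open>\<pi>\<close> commutes with the transposition of any two points \<open>(c, i)\<close> and \<open>(c, j)\<close> of a block, and
  therefore preserves the set of these two points. As a block has a third point \<open>(c, k)\<close>, the image of
  \<open>(c, i)\<close> lies in the intersection of \<open>{(c, i), (c, j)}\<close> and \<open>{(c, i), (c, k)}\<close>, so \<open>\<pi>\<close> fixes \<open>(c, i)\<close>.
\<close>

lemma centreless_block_group: "centreless (block_group C)"
proof -
  interpret W: group "block_group C" by (rule group_block_group)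
  have "\<pi> = \<one>\<^bsub>block_group C\<^esub>" if "\<pi> \<in> group_centre (block_group C)" for \<pi>
  proof -
    have \<pi>: "\<pi> \<in> block_perms C"
      and central: "\<And>\<sigma>. \<sigma> \<in> block_perms C \<Longrightarrow>
        \<pi> \<otimes>\<^bsub>BijGroup (block_points C)\<^esub> \<sigma> = \<sigma> \<otimes>\<^bsub>BijGroup (block_points C)\<^esub> \<pi>"
      using that by (auto simp: group_centre_def block_group_simps)
    note \<pi>B = block_perms_Bij[OF \<pi>]
    have inj: "inj_on \<pi> (block_points C)" using \<pi>B by (simp add: Bij_def bij_betw_def)
    have moved_to: "\<pi> (c, i) \<in> {(c, i), (c, j)}"
      if c: "c \<in> carrier C" and ij: "i < 3" "j < 3" "i \<noteq> j" for c i j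
    proof (rule ccontr)
      assume not_mem: "\<pi> (c, i) \<notin> {(c, i), (c, j)}"
      \<comment> \<open>the transposition of the two points; it fixes every block, so its shift is \<open>\<one>\<close>\<close>
      define \<sigma> where "\<sigma> = (\<lambda>x\<in>block_points C.
        if x = (c, i) then (c, j) else if x = (c, j) then (c, i) else x)"
      have fst_\<sigma>: "fst (\<sigma> x) = fst x" if "x \<in> block_points C" for x
        using that by (auto simp: \<sigma>_def)
      have "bij_betw \<sigma> (block_points C) (block_points C)"
        by (rule bij_betwI[where g = \<sigma>]) (use c ij in \<open>auto simp: \<sigma>_def\<close>)
      then have \<sigma>: "\<sigma> \<in> block_perms C"
        using fst_\<sigma> by (auto simp: block_perms_def Bij_def \<sigma>_def intro!: bexI[of _ \<one>])
      have swapped: "(c, i) \<in> block_points C" "(c, j) \<in> block_points C" using c ij by auto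
      have "\<pi> (\<sigma> (c, i)) = \<sigma> (\<pi> (c, i))"
        using central[OF \<sigma>] BijGroup_mult_apply[OF \<pi>B block_perms_Bij[OF \<sigma>] swapped(1)]
          BijGroup_mult_apply[OF block_perms_Bij[OF \<sigma>] \<pi>B swapped(1)] by simp
      then have "\<pi> (c, j) = \<pi> (c, i)"
        using not_mem swapped Bij_mem[OF \<pi>B swapped(1)] by (auto simp: \<sigma>_def)
      then show False using inj swapped ij by (auto simp: inj_on_def)
    qed
    have "\<pi> (c, i) = (c, i)" if c: "c \<in> carrier C" and i: "i < 3" for c i
    proof -
      obtain j k :: nat where "j < 3" "k < 3" "i \<noteq> j" "i \<noteq> k" "j \<noteq> k"
        using that[of "if i = 0 then 1 else 0" "if i = 2 then 1 else 2"] i by (auto split: if_splits)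
      then show ?thesis using moved_to[OF c i, of j] moved_to[OF c i, of k] by auto
    qed
    moreover have "\<one>\<^bsub>block_group C\<^esub> \<in> Bij (block_points C)"
      using W.one_closed by (simp add: block_group_simps block_perms_Bij)
    ultimately show ?thesis
      by (intro Bij_ext[OF \<pi>B]) (auto simp: block_group_simps BijGroup_one_apply)
  qed
  moreover have "\<one>\<^bsub>block_group C\<^esub> \<in> group_centre (block_group C)"
    by (simp add: group_centre_def)
  ultimately show ?thesis unfolding centreless_def by blast
qed

end

text \<open>
  The wreath product projects onto \<open>C\<close> by its action on the blocks, and \<open>C\<close> embeds into it as the
  translations that preserve the position within a block. The retraction \<open>\<rho>\<close> is what makes the
  enlargement harmless: a normal subgroup of \<open>C\<close> has a preimage under \<open>\<rho>\<close>, which is normal in the larger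
  group and meets the copy of \<open>C\<close> in the original subgroup. An embedding alone would not provide this.
\<close>

lemma finite_group_retract_of_centreless:
  fixes C :: "('a, 'b) monoid_scheme"
  assumes "group C" "finite (carrier C)"
  obtains G :: "nat monoid" and \<rho> \<iota> where "group G" "finite (carrier G)" "centreless G"
    "\<rho> \<in> hom G C" "\<iota> \<in> hom C G" "\<And>c. c \<in> carrier C \<Longrightarrow> \<rho> (\<iota> c) = c"
proof -
  let ?W = "block_group C"
  interpret W: group ?W using assms(1) by (rule group_block_group)
  have fin: "finite (carrier ?W)" by (rule finite_block_group[OF assms])
  obtain e :: "('a \<times> nat \<Rightarrow> 'a \<times> nat) \<Rightarrow> nat" where e: "inj_on e (carrier ?W)"
    using finite_imp_inj_to_nat_seg[OF fin] by blast
  let ?G = "image_group e ?W"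
  have iso: "e \<in> iso ?W ?G" by (rule inj_imp_image_group_iso[OF e])
  have G: "group ?G" by (rule W.inj_imp_image_group_is_group[OF e])
  let ?d = "inv_into (carrier ?W) e"
  have d: "?d \<in> iso ?G ?W" by (rule W.iso_set_sym[OF iso])
  show thesis
  proof (rule that[of ?G "block_shift C \<circ> ?d" "e \<circ> block_translation C"])
    show "group ?G" by (rule G)
    show "finite (carrier ?G)" using fin by (simp add: image_group_carrier)
    show "centreless ?G"
      by (rule centreless_iso[OF W.is_group G iso centreless_block_group[OF assms(1)]])
    show "block_shift C \<circ> ?d \<in> hom ?G C"
      using d block_shift_hom[OF assms(1)] by (auto simp: iso_def intro: hom_compose)
    show "e \<circ> block_translation C \<in> hom C ?G"
      using iso block_translation_hom[OF assms(1)] by (auto simp: iso_def intro: hom_compose)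
    fix c assume c: "c \<in> carrier C"
    then have "block_translation C c \<in> carrier ?W"
      using block_translation_hom[OF assms(1)] by (auto simp: hom_def)
    then show "(block_shift C \<circ> ?d) ((e \<circ> block_translation C) c) = c"
      using e c by (simp add: block_shift_translation[OF assms(1)])
  qed
qed

section \<open>Finite stages\<close>

text \<open>
  The image of \<open>F\<close> in the finite group \<open>C\<close> supplied by LEF-separation may have a centre, and \<open>\<phi> ` N1\<close> need
  not be normal in \<open>C\<close>. Restricting \<open>C\<close> to the image of \<open>\<phi>\<close> cures the second defect, and passing to a
  centreless group that retracts onto this image cures the first. The normal subgroup \<open>H\<close> is the
  preimage of \<open>\<phi> ` N1\<close> under the retraction, so that membership in \<open>H\<close> of a value of \<open>\<theta>\<close> is membership
  in \<open>\<phi> ` N1\<close> of the corresponding value of \<open>\<phi>\<close>.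
\<close>

lemma lef_separated_centreless_quotient:
  assumes "group F" "N1 \<lhd> F" "lef_separated F N N1"
    and "finite D1" "D1 \<subseteq> N" "finite D2" "D2 \<subseteq> carrier F - N"
  obtains G :: "nat monoid" and H \<theta> where "group G" "finite (carrier G)" "centreless G"
    "H \<lhd> G" "\<theta> \<in> hom F G" "\<theta> ` D1 \<subseteq> {\<one>\<^bsub>G\<^esub>}" "\<one>\<^bsub>G\<^esub> \<notin> \<theta> ` D2"
    "\<theta> ` N1 \<subseteq> H" "\<theta> ` (D2 - N1) \<inter> H = {}"
proof -
  have "\<exists>(C :: nat monoid) \<phi>. group C \<and> finite (carrier C) \<and> \<phi> \<in> hom F C \<and>
      \<phi> ` D1 \<subseteq> {\<one>\<^bsub>C\<^esub>} \<and> \<one>\<^bsub>C\<^esub> \<notin> \<phi> ` D2 \<and> \<phi> ` (D2 - N1) \<inter> \<phi> ` N1 = {}"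
    using assms(3-7) unfolding lef_separated_def by blast
  then obtain C :: "nat monoid" and \<phi> where C: "group C" "finite (carrier C)" "\<phi> \<in> hom F C"
    and D: "\<phi> ` D1 \<subseteq> {\<one>\<^bsub>C\<^esub>}" "\<one>\<^bsub>C\<^esub> \<notin> \<phi> ` D2" "\<phi> ` (D2 - N1) \<inter> \<phi> ` N1 = {}"
    by blast
  interpret \<phi>: group_hom F C \<phi>
    using assms(1) C by (simp add: group_hom_def group_hom_axioms_def)
  let ?Q = "C\<lparr>carrier := \<phi> ` carrier F\<rparr>"
  have Q: "group ?Q" by (rule subgroup.subgroup_is_group[OF \<phi>.img_is_subgroup C(1)])
  have Q_fin: "finite (carrier ?Q)"
    using finite_subset[OF subgroup.subset[OF \<phi>.img_is_subgroup] C(2)] by simp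
  have \<phi>Q: "\<phi> \<in> hom F ?Q" using C(3) by (auto simp: hom_def)
  have "\<phi> ` N1 \<lhd> ?Q"
    by (rule normal.surj_hom_normal_subgroup[OF assms(2)])
      (use assms(1) Q \<phi>Q in \<open>auto simp: group_hom_def group_hom_axioms_def\<close>)
  obtain G :: "nat monoid" and \<rho> \<iota> where G: "group G" "finite (carrier G)" "centreless G"
    and \<rho>: "\<rho> \<in> hom G ?Q" and \<iota>: "\<iota> \<in> hom ?Q G"
    and retract: "\<And>c. c \<in> carrier ?Q \<Longrightarrow> \<rho> (\<iota> c) = c"
    using finite_group_retract_of_centreless[OF Q Q_fin] by blast
  have \<theta>: "\<iota> \<circ> \<phi> \<in> hom F G" by (rule hom_compose[OF \<phi>Q \<iota>])
  have \<rho>\<theta>: "\<rho> ((\<iota> \<circ> \<phi>) x) = \<phi> x" if "x \<in> carrier F" for x using retract that by simp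
  have \<rho>1: "\<rho> \<one>\<^bsub>G\<^esub> = \<one>\<^bsub>C\<^esub>" using hom_one[OF \<rho> G(1) Q] by simp
  have \<iota>1: "\<iota> \<one>\<^bsub>C\<^esub> = \<one>\<^bsub>G\<^esub>" using hom_one[OF \<iota> Q G(1)] by simp
  have N1: "N1 \<subseteq> carrier F" using normal_imp_subgroup[OF assms(2)] subgroup.subset by blast
  show thesis
  proof (rule that[OF G normal_hom_preimage[OF G(1) \<rho> \<open>\<phi> ` N1 \<lhd> ?Q\<close>] \<theta>])
    show "(\<iota> \<circ> \<phi>) ` D1 \<subseteq> {\<one>\<^bsub>G\<^esub>}" using D(1) \<iota>1 by auto
    show "\<one>\<^bsub>G\<^esub> \<notin> (\<iota> \<circ> \<phi>) ` D2"
    proof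
      assume "\<one>\<^bsub>G\<^esub> \<in> (\<iota> \<circ> \<phi>) ` D2"
      then obtain x where x: "x \<in> D2" "(\<iota> \<circ> \<phi>) x = \<one>\<^bsub>G\<^esub>" by auto
      then have "\<phi> x = \<one>\<^bsub>C\<^esub>" using \<rho>\<theta>[of x] \<rho>1 assms(7) by auto
      then show False using D(2) x(1) by (metis image_eqI)
    qed
    show "(\<iota> \<circ> \<phi>) ` N1 \<subseteq> {x \<in> carrier G. \<rho> x \<in> \<phi> ` N1}"
    proof
      fix y assume "y \<in> (\<iota> \<circ> \<phi>) ` N1"
      then obtain x where x: "x \<in> N1" "y = (\<iota> \<circ> \<phi>) x" by blast
      then show "y \<in> {x \<in> carrier G. \<rho> x \<in> \<phi> ` N1}"
        using \<rho>\<theta>[of x] N1 hom_in_carrier[OF \<theta>, of x] by auto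
    qed
    show "(\<iota> \<circ> \<phi>) ` (D2 - N1) \<inter> {x \<in> carrier G. \<rho> x \<in> \<phi> ` N1} = {}"
    proof -
      have "\<rho> ((\<iota> \<circ> \<phi>) x) \<notin> \<phi> ` N1" if "x \<in> D2 - N1" for x
        using \<rho>\<theta>[of x] that assms(7) D(3) by blast
      then show ?thesis by blast
    qed
  qed
qed

lemma conj_length_pos:
  fixes G (structure)
  assumes "group G" "finite (carrier G)" "g \<in> carrier G" "g \<notin> group_centre G"
  shows "0 < conj_length G g"
proof -
  interpret group G by fact
  obtain h where h: "h \<in> carrier G" "g \<otimes> h \<noteq> h \<otimes> g"
    using assms(3,4) by (auto simp: group_centre_def)
  have "inv h \<otimes> g \<otimes> h \<noteq> g"
  proof
    assume eq: "inv h \<otimes> g \<otimes> h = g"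
    have "g \<otimes> h = h \<otimes> (inv h \<otimes> g \<otimes> h)"
      using h assms(3) by (metis inv_closed inv_solve_left m_assoc m_closed)
    then show False using h eq by simp
  qed
  moreover have "{inv h \<otimes> g \<otimes> h, g} \<subseteq> conj_class G g"
    using h conj_class_subset(2)[OF assms(1,3)] by (auto simp: conj_class_def)
  moreover have "finite (conj_class G g)" using assms(2) by (simp add: conj_class_def)
  ultimately have "2 \<le> card (conj_class G g)"
    using card_mono[of "conj_class G g" "{inv h \<otimes> g \<otimes> h, g}"] by simp
  moreover have "card (conj_class G g) \<le> card (carrier G)"
    by (rule card_conj_class(2)[OF assms(1-3)])
  ultimately show ?thesis unfolding conj_length_def
    by (intro divide_pos_pos ln_gt_zero) auto
qed

text \<open>
  In a centreless finite group each of the finitely many nontrivial elements has positive conjugacy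
  length, and \<open>root s a\<close> tends to \<open>1\<close> as \<open>s\<close> grows, for every \<open>a > 0\<close>. This is why the exponent \<open>s\<close> must
  be allowed to depend on the group: conjugacy lengths themselves may tend to \<open>0\<close> along a family.
\<close>

lemma uniform_root_conj_length:
  assumes "group G" "finite (carrier G)" "centreless G"
  obtains s where "1 \<le> s"
    "\<And>g. g \<in> carrier G \<Longrightarrow> g \<noteq> \<one>\<^bsub>G\<^esub> \<Longrightarrow> 1 / 2 \<le> root s (conj_length G g)"
proof -
  have "eventually (\<lambda>s. 1 / 2 \<le> root s (conj_length G g)) sequentially"
    if "g \<in> carrier G - {\<one>\<^bsub>G\<^esub>}" for g
  proof -
    have "0 < conj_length G g"
      using that assms by (intro conj_length_pos) (auto simp: centreless_def)
    then have "(\<lambda>s. root s (conj_length G g)) \<longlonglongrightarrow> 1" by (rule LIMSEQ_root_const)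
    then have "eventually (\<lambda>s. 1 / 2 < root s (conj_length G g)) sequentially"
      by (rule order_tendstoD) simp
    then show ?thesis by eventually_elim simp
  qed
  then have "eventually (\<lambda>s. \<forall>g\<in>carrier G - {\<one>\<^bsub>G\<^esub>}. 1 / 2 \<le> root s (conj_length G g)) sequentially"
    using assms(2) by (intro eventually_ball_finite) auto
  then have "eventually (\<lambda>s. 1 \<le> s \<and> (\<forall>g\<in>carrier G - {\<one>\<^bsub>G\<^esub>}. 1 / 2 \<le> root s (conj_length G g)))
      sequentially"
    using eventually_ge_at_top[of "1::nat"] by eventually_elim simp
  then show thesis using that by (auto simp: eventually_sequentially)
qed

text \<open>
  With \<open>t = 1\<close> the root is divided by \<open>2\<close>. So the nontrivial elements of \<open>H\<close> have lengths bounded away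
  from \<open>0\<close> by a constant that is the same for all groups, and at most the threshold \<open>1 / 2\<close>.
\<close>

lemma conj_length_star_half_bounds:
  assumes "group G" "finite (carrier G)" "centreless G"
  obtains s where "1 \<le> s"
    "\<And>g. g \<in> H \<Longrightarrow> g \<in> carrier G \<Longrightarrow> g \<noteq> \<one>\<^bsub>G\<^esub> \<Longrightarrow>
      conj_length_star G H s 1 g \<in> {1 / 4..1 / 2}"
proof -
  obtain s where s: "1 \<le> s"
    "\<And>g. g \<in> carrier G \<Longrightarrow> g \<noteq> \<one>\<^bsub>G\<^esub> \<Longrightarrow> 1 / 2 \<le> root s (conj_length G g)"
    using uniform_root_conj_length[OF assms] by blast
  moreover have "root s (conj_length G g) \<le> 1" if "g \<in> carrier G" for g
    using conj_length_le_1[OF assms(1,2) that] s(1) by simp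
  ultimately show thesis using that[of s] by (fastforce simp: conj_length_star_def)
qed

text \<open>
  A finite approximation of the pair \<open>N \<subseteq> N1\<close> that separates the elements of \<open>E\<close>. The inclusion
  \<open>\<theta> ` N1 \<subseteq> H\<close> and the clause on \<open>E\<close> together make \<open>\<theta> x \<in> H\<close> equivalent to \<open>x \<in> N1\<close> for \<open>x \<in> E\<close>.
  The bound \<open>1 / 4\<close> is the same for all stages, so that it passes to the ultralimit.
\<close>

definition separating_stage ::
    "('a, 'b) monoid_scheme \<Rightarrow> 'a set \<Rightarrow> 'a set \<Rightarrow> 'a set \<Rightarrow>
      ('c, 'd) monoid_scheme \<Rightarrow> 'c set \<Rightarrow> nat \<Rightarrow> ('a \<Rightarrow> 'c) \<Rightarrow> bool" where
  "separating_stage F N N1 E G H s \<theta> \<longleftrightarrow>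
     group G \<and> finite (carrier G) \<and> centreless G \<and> H \<lhd> G \<and> 1 \<le> s \<and>
     \<theta> \<in> hom F G \<and> \<theta> ` N1 \<subseteq> H \<and>
     (\<forall>g\<in>H. g \<noteq> \<one>\<^bsub>G\<^esub> \<longrightarrow> conj_length_star G H s 1 g \<in> {1 / 4..1 / 2}) \<and>
     (\<forall>x\<in>E. (\<theta> x = \<one>\<^bsub>G\<^esub> \<longleftrightarrow> x \<in> N) \<and> (\<theta> x \<in> H \<longrightarrow> x \<in> N1))"

lemma separating_stage_exists:
  assumes "group F" "N1 \<lhd> F" "N \<subseteq> N1" "lef_separated F N N1"
    and "finite E" "E \<subseteq> carrier F"
  shows "\<exists>(G :: nat monoid) H s \<theta>. separating_stage F N N1 E G H s \<theta>"
proof -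
  have D: "finite (E \<inter> N)" "E \<inter> N \<subseteq> N" "finite (E - N)" "E - N \<subseteq> carrier F - N"
    using assms(5,6) by auto
  obtain G :: "nat monoid" and H \<theta> where G: "group G" "finite (carrier G)" "centreless G"
    "H \<lhd> G" "\<theta> \<in> hom F G" and \<theta>: "\<theta> ` (E \<inter> N) \<subseteq> {\<one>\<^bsub>G\<^esub>}" "\<one>\<^bsub>G\<^esub> \<notin> \<theta> ` (E - N)"
    "\<theta> ` N1 \<subseteq> H" "\<theta> ` ((E - N) - N1) \<inter> H = {}"
    using lef_separated_centreless_quotient[OF assms(1,2,4) D] by blast
  have H: "H \<subseteq> carrier G" using normal_imp_subgroup[OF G(4)] subgroup.subset by blast
  obtain s where s: "1 \<le> s" "\<And>g. g \<in> H \<Longrightarrow> g \<in> carrier G \<Longrightarrow> g \<noteq> \<one>\<^bsub>G\<^esub> \<Longrightarrow>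
      conj_length_star G H s 1 g \<in> {1 / 4..1 / 2}"
    using conj_length_star_half_bounds[OF G(1-3)] by blast
  have "(\<theta> x = \<one>\<^bsub>G\<^esub> \<longleftrightarrow> x \<in> N) \<and> (\<theta> x \<in> H \<longrightarrow> x \<in> N1)" if x: "x \<in> E" for x
  proof -
    have "\<theta> x = \<one>\<^bsub>G\<^esub>" if "x \<in> N" using \<theta>(1) x that by blast
    moreover have "\<theta> x \<noteq> \<one>\<^bsub>G\<^esub>" if "x \<notin> N" using \<theta>(2) x that by (metis DiffI image_eqI)
    moreover have "\<theta> x \<notin> H" if "x \<notin> N1" using \<theta>(4) x that assms(3) by blast
    ultimately show ?thesis by blast
  qed
  then have "separating_stage F N N1 E G H s \<theta>"
    unfolding separating_stage_def using G \<theta>(3) s H by blast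
  then show ?thesis by blast
qed

section \<open>The embedding into the metric ultraproduct\<close>

theorem proposition4p6:
  fixes F :: "('a, 'b) monoid_scheme" and N N1 :: "'a set"
  assumes "free_group F" and "finitely_generated_group F"
    and "N \<lhd> F" and "N1 \<lhd> F" and "N \<subseteq> N1"
    and "lef_group (F Mod N)" and "centreless (F Mod N)"
    and "lef_separated F N N1"
  shows "\<exists>(I :: nat set) (\<Phi> :: nat filter) (G :: nat \<Rightarrow> nat monoid)
            (H :: nat \<Rightarrow> nat set) (s :: nat \<Rightarrow> nat) (t :: nat \<Rightarrow> nat) (l :: nat \<Rightarrow> nat \<Rightarrow> real) \<psi>.
           ultrafilter_on I \<Phi> \<and>
           (\<forall>i\<in>I. group (G i) \<and> finite (carrier (G i)) \<and> centreless (G i) \<and>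
                  H i \<lhd> G i \<and> 1 \<le> s i \<and> 1 \<le> t i \<and>
                  l i = conj_length_star (G i) (H i) (s i) (t i)) \<and>
           \<psi> \<in> mon (F Mod N) (metric_ultraproduct I \<Phi> G l) \<and>
           (\<lambda>x. N #>\<^bsub>F\<^esub> x) ` N1 =
             {p \<in> carrier (F Mod N). ultraproduct_norm \<Phi> l (\<psi> p) \<le> 1 / 2}"
proof -
  interpret N: normal N F by fact
  interpret N1: normal N1 F by fact
  have F: "group F" by (rule N.is_group)
  have "countable (carrier F)"
    using assms(2) countable_generate[OF F] countable_finite
    unfolding finitely_generated_group_def by metis
  then obtain e :: "nat \<Rightarrow> 'a" where e: "range e = carrier F"
    using N.one_closed by (metis N.subset empty_iff range_from_nat_into subset_empty)
  have "\<exists>(G :: nat monoid) H s \<theta>. separating_stage F N N1 (e ` {..n}) G H s \<theta>" for n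
    by (rule separating_stage_exists[OF F assms(4,5,8)]) (use e in auto)
  then obtain G :: "nat \<Rightarrow> nat monoid" and H s \<theta> where
    stage: "\<And>n. separating_stage F N N1 (e ` {..n}) (G n) (H n) (s n) (\<theta> n)"
    by metis
  note stage' = stage[unfolded separating_stage_def]
  have G: "group (G n)" "finite (carrier (G n))" "centreless (G n)"
      "H n \<lhd> G n" "1 \<le> s n" "\<theta> n \<in> hom F (G n)" "\<theta> n ` N1 \<subseteq> H n" for n
    using stage'[of n] by blast+
  have len: "conj_length_star (G n) (H n) (s n) 1 g \<in> {1 / 4..1 / 2}"
    if "g \<in> H n" "g \<noteq> \<one>\<^bsub>G n\<^esub>" for n g
    using stage'[of n] that by blast
  have \<theta>: "\<theta> n x = \<one>\<^bsub>G n\<^esub> \<longleftrightarrow> x \<in> N" "x \<notin> N1 \<Longrightarrow> \<theta> n x \<notin> H n" if "x \<in> e ` {..n}" for n x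
    using stage'[of n] that by blast+
  define l where "l n = conj_length_star (G n) (H n) (s n) 1" for n
  have l: "invariant_pseudo_length (G n) (l n)" for n
    unfolding l_def by (rule invariant_pseudo_length_conj_length_star) (use G in auto)
  have l_le: "l n g \<le> 1" if "g \<in> carrier (G n)" for n g
    unfolding l_def by (rule conj_length_star_bounds(2)[OF G(1,2,5) that])
  have one: "l n \<one>\<^bsub>G n\<^esub> = 0" for n using l by (simp add: invariant_pseudo_length_def)
  obtain \<Phi> :: "nat filter" where \<Phi>: "ultrafilter_on UNIV \<Phi>" "\<Phi> \<le> sequentially"
    using ultrafilter_finer_than[of sequentially] by auto
  have nonbot: "\<Phi> \<noteq> bot" using \<Phi>(1) by (simp add: ultrafilter_on_def)
  have seen: "eventually (\<lambda>n. x \<in> e ` {..n}) \<Phi>" if "x \<in> carrier F" for x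
  proof -
    obtain m where "x = e m" using e \<open>x \<in> carrier F\<close> by (metis imageE)
    then have "eventually (\<lambda>n. x \<in> e ` {..n}) sequentially"
      by (intro eventually_sequentiallyI[of m]) simp
    then show ?thesis using \<Phi>(2) by (simp add: le_filter_def)
  qed
  let ?\<Pi> = "product_group UNIV G"
  let ?K = "null_subgroup UNIV \<Phi> G l"
  let ?U = "metric_ultraproduct UNIV \<Phi> G l"
  define \<Theta> where "\<Theta> x = (\<lambda>n. \<theta> n x)" for x
  have \<Theta>: "\<Theta> \<in> hom F ?\<Pi>"
    using G(6) by (auto simp: hom_def \<Theta>_def Pi_iff)
  have \<Theta>_carrier: "\<Theta> x \<in> carrier ?\<Pi>" if "x \<in> carrier F" for x
    by (rule hom_in_carrier[OF \<Theta> that])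
  interpret \<Pi>: group ?\<Pi> using G(1) by simp
  interpret K: normal ?K ?\<Pi>
    by (rule null_subgroup_normal[OF \<Phi>(1)]) (use G l in auto)
  let ?norm = "\<lambda>x. ultraproduct_norm \<Phi> l (?K #>\<^bsub>?\<Pi>\<^esub> \<Theta> x)"
  have norm: "((\<lambda>n. l n (\<theta> n x)) \<longlongrightarrow> ?norm x) \<Phi>" if "x \<in> carrier F" for x
    using ultraproduct_norm_eq[OF \<Phi>(1) G(1) l l_le \<Theta>_carrier[OF that]] by (simp add: \<Theta>_def)
  \<comment> \<open>The norm of an element is read off from the stages that have already seen it: it is \<open>0\<close> on \<open>N\<close>,
    between \<open>1 / 4\<close> and \<open>1 / 2\<close> on \<open>N1 - N\<close>, and \<open>1\<close> outside \<open>N1\<close>.\<close>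
  have norm_N: "?norm x = 0" if "x \<in> N" for x
  proof -
    have x: "x \<in> carrier F" using that by (rule N.mem_carrier)
    have "eventually (\<lambda>n. l n (\<theta> n x) = 0) \<Phi>"
      using seen[OF x] by eventually_elim (metis \<theta>(1) that one)
    then have "((\<lambda>n. l n (\<theta> n x)) \<longlongrightarrow> 0) \<Phi>" by (rule tendsto_eventually)
    then show ?thesis using tendsto_unique[OF nonbot norm[OF x]] by blast
  qed
  have norm_N1: "1 / 4 \<le> ?norm x \<and> ?norm x \<le> 1 / 2" if "x \<in> N1" "x \<notin> N" for x
  proof -
    have x: "x \<in> carrier F" using that(1) by (rule N1.mem_carrier)
    have ev: "eventually (\<lambda>n. 1 / 4 \<le> l n (\<theta> n x) \<and> l n (\<theta> n x) \<le> 1 / 2) \<Phi>"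
      using seen[OF x]
    proof eventually_elim
      case (elim n)
      have "\<theta> n x \<in> H n" using G(7) that(1) by blast
      then show ?case using len[of "\<theta> n x" n] \<theta>(1)[OF elim] that(2) by (simp add: l_def)
    qed
    have "1 / 4 \<le> ?norm x"
      by (rule tendsto_lowerbound[OF norm[OF x] _ nonbot]) (use ev in eventually_elim, simp)
    moreover have "?norm x \<le> 1 / 2"
      by (rule tendsto_upperbound[OF norm[OF x] _ nonbot]) (use ev in eventually_elim, simp)
    ultimately show ?thesis by blast
  qed
  have norm_out: "?norm x = 1" if "x \<in> carrier F" "x \<notin> N1" for x
  proof -
    have "eventually (\<lambda>n. l n (\<theta> n x) = 1) \<Phi>"
      using seen[OF that(1)] by eventually_elim (simp add: \<theta>(2) that l_def conj_length_star_def)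
    then have "((\<lambda>n. l n (\<theta> n x)) \<longlongrightarrow> 1) \<Phi>" by (rule tendsto_eventually)
    then show ?thesis using tendsto_unique[OF nonbot norm[OF that(1)]] by blast
  qed
  have null_iff: "\<Theta> x \<in> ?K \<longleftrightarrow> x \<in> N" if x: "x \<in> carrier F" for x
  proof -
    have "\<Theta> x \<in> ?K \<longleftrightarrow> ((\<lambda>n. l n (\<theta> n x)) \<longlongrightarrow> 0) \<Phi>"
      using \<Theta>_carrier[OF x] unfolding null_subgroup_def by (simp add: \<Theta>_def)
    also have "\<dots> \<longleftrightarrow> ?norm x = 0"
      using norm[OF x] tendsto_unique[OF nonbot norm[OF x]] by metis
    also have "\<dots> \<longleftrightarrow> x \<in> N"
      using norm_N norm_N1[of x] norm_out[OF x] by (cases "x \<in> N"; cases "x \<in> N1") auto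
    finally show ?thesis .
  qed
  define \<kappa> where "\<kappa> = (\<lambda>y. ?K #>\<^bsub>?\<Pi>\<^esub> y) \<circ> \<Theta>"
  have U: "group ?U" using G(1) l by (intro group_metric_ultraproduct[OF \<Phi>(1)]) auto
  have \<kappa>: "\<kappa> \<in> hom F ?U"
    unfolding \<kappa>_def metric_ultraproduct_def by (rule hom_compose[OF \<Theta> K.r_coset_hom_Mod])
  interpret \<kappa>: group_hom F ?U \<kappa>
    using F U \<kappa> by (simp add: group_hom_def group_hom_axioms_def)
  have ker: "kernel F ?U \<kappa> = N"
  proof -
    have "\<kappa> x = \<one>\<^bsub>?U\<^esub> \<longleftrightarrow> \<Theta> x \<in> ?K" if "x \<in> carrier F" for x
      using \<Pi>.coset_join1[of ?K "\<Theta> x"] \<Pi>.coset_join2[OF \<Theta>_carrier[OF that] K.subgroup_axioms]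
        \<Theta>_carrier[OF that] K.subgroup_axioms K.subset
      by (simp add: \<kappa>_def metric_ultraproduct_def del: carrier_product_group) blast
    then show ?thesis using null_iff N.subset by (auto simp: kernel_def)
  qed
  define \<psi> where "\<psi> X = the_elem (\<kappa> ` X)" for X
  have \<psi>: "\<psi> \<in> mon (F Mod N) ?U"
    using \<kappa>.FactGroup_hom \<kappa>.FactGroup_inj_on by (simp add: mon_def \<psi>_def[abs_def] ker)
  have \<psi>_coset: "\<psi> (N #>\<^bsub>F\<^esub> x) = ?K #>\<^bsub>?\<Pi>\<^esub> \<Theta> x" if x: "x \<in> carrier F" for x
  proof -
    have "\<kappa> y = \<kappa> x" if y: "y \<in> N #>\<^bsub>F\<^esub> x" for y
    proof -
      obtain n where n: "n \<in> N" "y = n \<otimes>\<^bsub>F\<^esub> x" using y by (auto simp: r_coset_def)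
      then have "\<kappa> n = \<one>\<^bsub>?U\<^esub>" using ker by (auto simp: kernel_def)
      then show ?thesis using n x N.mem_carrier[OF n(1)] by simp
    qed
    then have "\<kappa> ` (N #>\<^bsub>F\<^esub> x) = {\<kappa> x}"
      using N.rcos_self[OF x N.subgroup_axioms] by blast
    then show ?thesis by (simp add: \<psi>_def \<kappa>_def)
  qed
  have "(\<lambda>x. N #>\<^bsub>F\<^esub> x) ` N1 = {p \<in> carrier (F Mod N). ultraproduct_norm \<Phi> l (\<psi> p) \<le> 1 / 2}"
  proof -
    have "ultraproduct_norm \<Phi> l (\<psi> (N #>\<^bsub>F\<^esub> x)) \<le> 1 / 2 \<longleftrightarrow> x \<in> N1" if x: "x \<in> carrier F" for x
      using norm_N[of x] norm_N1[of x] norm_out[OF x]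
      by (cases "x \<in> N"; cases "x \<in> N1") (use assms(5) in \<open>auto simp: \<psi>_coset[OF x]\<close>)
    then show ?thesis using N1.subset by (auto simp: carrier_FactGroup)
  qed
  then show ?thesis
    using \<Phi>(1) G \<psi>
    by (intro exI[of _ UNIV] exI[of _ \<Phi>] exI[of _ G] exI[of _ H] exI[of _ s] exI[of _ "\<lambda>_. 1"]
        exI[of _ l] exI[of _ \<psi>]) (auto simp: l_def)
qed

end
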